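(* Let $P$ be a left skew-pregroupoid with unique right preinverses, and let $P[\mathsf{m}]$ be the set $P$ equipped with the restricted partial binary operation $\mathsf{m}:(x,y)\mapsto x\cdot y$, where $x\cdot y$ is defined if and only if $x(yy^{-1})$ is defined and $x(yy^{-1})=x$, in which case $x\cdot y=xy$. Then $P[\mathsf{m}]$ is a left skew-groupoid.
   Context: A magmoid is a non-empty set $P$ with a non-empty partial binary operation $(x,y)\mapsto xy$. A compound product such as $(xy)z$ is defined iff $xy$ is defined and the product of $xy$ with $z$ is defined (similarly for $x(yz)$). An asserted equation between products includes the assertion that both sides are defined. A left semigroupoid is a magmoid $P$ such that for all $x,y,z\in P$: if $x(yz)$ is defined, or if both $xy$ and $yz$ are defined, then $x(yz)=(xy)z$ (both sides defined). A local left unit for $x$ is some $\lambda_x$ with $\lambda_x x=x$ (product defined). A right preinverse of $x$ is some $x^{-1}$ such that $(xx^{-1})x=x$ and $(x^{-1}x)x^{-1}=x^{-1}$ (all products defined). A left skew-prepoloid is a left semigroupoid in which every element has a local left unit. A left skew-pregroupoid is a left skew-prepoloid in which every element has a right preinverse; it has unique right preinverses if every $x$ has exactly one right preinverse, denoted $x^{-1}$. (If $x(yy^{-1})$ is defined then $xy$ is defined, so the restricted operation is well defined.) A right unit in a magmoid $Q$ is some $\varepsilon\in Q$ such that for every $y\in Q$, if $y\varepsilon$ is defined then $y\varepsilon=y$. A twisted left unit for $x\in Q$ is a local left unit for $x$ that is also a right unit in $Q$. A left skew-poloid is a left semigroupoid in which every element $x$ has a unique twisted left unit $\varphi_x$.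 A strong right preinverse of $x$ is a right preinverse $x^{-1}$ of $x$ such that $xx^{-1}$ and $x^{-1}x$ are right units. A left skew-groupoid is a left skew-poloid such that every $x$ has a strong right preinverse and, moreover, all strong right preinverses of $x$ have the same twisted left unit (so that, for strong right preinverses $x',x''$ of $x$, $xx'=\varphi_x=xx''$ and $x'x=\varphi_{x'}=\varphi_{x''}=x''x$). *)

theory Defs
  imports Main
begin

text \<open>
  A partial binary operation on a carrier \<open>P\<close> is a function \<open>m\<close> into an option type, with
  \<open>m x y = None\<close> meaning that the product \<open>xy\<close> is undefined.  All notions only inspect
  \<open>m\<close> on \<open>P\<close>; its values outside \<open>P\<close> are irrelevant.  An asserted equation between products
  is rendered with \<open>Some\<close>, so that it includes definedness of both sides.
\<close>

type_synonym 'a partial_op = "'a \<Rightarrow> 'a \<Rightarrow> 'a option"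

text \<open>The compound products \<open>x(yz)\<close> and \<open>(xy)z\<close>, defined iff both products involved are.\<close>

definition prod_right :: "'a partial_op \<Rightarrow> 'a \<Rightarrow> 'a \<Rightarrow> 'a \<Rightarrow> 'a option" where
  "prod_right m x y z = Option.bind (m y z) (\<lambda>w. m x w)"

definition prod_left :: "'a partial_op \<Rightarrow> 'a \<Rightarrow> 'a \<Rightarrow> 'a \<Rightarrow> 'a option" where
  "prod_left m x y z = Option.bind (m x y) (\<lambda>w. m w z)"

definition magmoid :: "'a set \<Rightarrow> 'a partial_op \<Rightarrow> bool" where
  "magmoid P m \<longleftrightarrow>
     P \<noteq> {} \<and>
     (\<forall>x\<in>P. \<forall>y\<in>P. \<forall>z. m x y = Some z \<longrightarrow> z \<in> P) \<and>
     (\<exists>x\<in>P. \<exists>y\<in>P. m x y \<noteq> None)"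

definition left_semigroupoid :: "'a set \<Rightarrow> 'a partial_op \<Rightarrow> bool" where
  "left_semigroupoid P m \<longleftrightarrow>
     magmoid P m \<and>
     (\<forall>x\<in>P. \<forall>y\<in>P. \<forall>z\<in>P.
        prod_right m x y z \<noteq> None \<or> (m x y \<noteq> None \<and> m y z \<noteq> None) \<longrightarrow>
        (\<exists>p. prod_right m x y z = Some p \<and> prod_left m x y z = Some p))"

definition local_left_unit :: "'a set \<Rightarrow> 'a partial_op \<Rightarrow> 'a \<Rightarrow> 'a \<Rightarrow> bool" where
  "local_left_unit P m x l \<longleftrightarrow> l \<in> P \<and> m l x = Some x"

definition right_preinverse :: "'a set \<Rightarrow> 'a partial_op \<Rightarrow> 'a \<Rightarrow> 'a \<Rightarrow> bool" where
  "right_preinverse P m x y \<longleftrightarrow>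
     y \<in> P \<and> prod_left m x y x = Some x \<and> prod_left m y x y = Some y"

definition left_skew_prepoloid :: "'a set \<Rightarrow> 'a partial_op \<Rightarrow> bool" where
  "left_skew_prepoloid P m \<longleftrightarrow>
     left_semigroupoid P m \<and> (\<forall>x\<in>P. \<exists>l. local_left_unit P m x l)"

definition left_skew_pregroupoid :: "'a set \<Rightarrow> 'a partial_op \<Rightarrow> bool" where
  "left_skew_pregroupoid P m \<longleftrightarrow>
     left_skew_prepoloid P m \<and> (\<forall>x\<in>P. \<exists>y. right_preinverse P m x y)"

definition unique_right_preinverses :: "'a set \<Rightarrow> 'a partial_op \<Rightarrow> bool" where
  "unique_right_preinverses P m \<longleftrightarrow> (\<forall>x\<in>P. \<exists>!y. right_preinverse P m x y)"

text \<open>The element \<open>x\<^sup>-\<^sup>1\<close>; only meaningful if right preinverses are unique.\<close>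

definition right_preinv :: "'a set \<Rightarrow> 'a partial_op \<Rightarrow> 'a \<Rightarrow> 'a" where
  "right_preinv P m x = (THE y. right_preinverse P m x y)"

definition restricted_op :: "'a set \<Rightarrow> 'a partial_op \<Rightarrow> 'a partial_op" where
  "restricted_op P m x y =
     (if prod_right m x y (right_preinv P m y) = Some x then m x y else None)"

definition right_unit :: "'a set \<Rightarrow> 'a partial_op \<Rightarrow> 'a \<Rightarrow> bool" where
  "right_unit Q m e \<longleftrightarrow> e \<in> Q \<and> (\<forall>y\<in>Q. m y e \<noteq> None \<longrightarrow> m y e = Some y)"

definition twisted_left_unit :: "'a set \<Rightarrow> 'a partial_op \<Rightarrow> 'a \<Rightarrow> 'a \<Rightarrow> bool" where
  "twisted_left_unit Q m x u \<longleftrightarrow> local_left_unit Q m x u \<and> right_unit Q m u"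

definition left_skew_poloid :: "'a set \<Rightarrow> 'a partial_op \<Rightarrow> bool" where
  "left_skew_poloid Q m \<longleftrightarrow>
     left_semigroupoid Q m \<and> (\<forall>x\<in>Q. \<exists>!u. twisted_left_unit Q m x u)"

text \<open>The element \<open>\<phi>\<^sub>x\<close>; only meaningful in a left skew-poloid.\<close>

definition the_twisted_left_unit :: "'a set \<Rightarrow> 'a partial_op \<Rightarrow> 'a \<Rightarrow> 'a" where
  "the_twisted_left_unit Q m x = (THE u. twisted_left_unit Q m x u)"

definition strong_right_preinverse :: "'a set \<Rightarrow> 'a partial_op \<Rightarrow> 'a \<Rightarrow> 'a \<Rightarrow> bool" where
  "strong_right_preinverse Q m x y \<longleftrightarrow>
     right_preinverse Q m x y \<and>
     (\<exists>e. m x y = Some e \<and> right_unit Q m e) \<and>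
     (\<exists>f. m y x = Some f \<and> right_unit Q m f)"

definition left_skew_groupoid :: "'a set \<Rightarrow> 'a partial_op \<Rightarrow> bool" where
  "left_skew_groupoid Q m \<longleftrightarrow>
     left_skew_poloid Q m \<and>
     (\<forall>x\<in>Q. \<exists>y. strong_right_preinverse Q m x y) \<and>
     (\<forall>x\<in>Q. \<forall>y z. strong_right_preinverse Q m x y \<longrightarrow> strong_right_preinverse Q m x z \<longrightarrow>
        the_twisted_left_unit Q m y = the_twisted_left_unit Q m z)"

end

theory Submission
  imports Defs
begin

text \<open>
  Write \<open>e\<^sub>x = xx\<^sup>-\<^sup>1\<close>, so that \<open>x \<cdot> y\<close> is defined iff \<open>xe\<^sub>y = x\<close>.  The key fact is that
  \<open>ye\<^sub>z = y\<close> implies \<open>e\<^bsub>yz\<^esub> = e\<^sub>y\<close>.  The naive inverse \<open>z\<^sup>-\<^sup>1y\<^sup>-\<^sup>1\<close> of \<open>yz\<close> need not be defined;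
  instead, with \<open>f = y\<^sup>-\<^sup>1y\<close> and \<open>w = fz\<close>, both \<open>w\<^sup>-\<^sup>1\<close> and \<open>w\<^sup>-\<^sup>1f\<close> are right preinverses of \<open>w\<close>,
  hence equal, which gives \<open>ww\<^sup>-\<^sup>1 = f\<close> and makes \<open>w\<^sup>-\<^sup>1y\<^sup>-\<^sup>1\<close> the right preinverse of \<open>yz\<close>.
  Associativity of the restricted operation follows.  Each \<open>e\<^sub>x\<close> equals its own right preinverse,
  hence is a twisted left unit for \<open>x\<close>.  Conversely, if \<open>u\<close> is one, then \<open>ux = x\<close> gives
  \<open>e\<^sub>u = e\<^sub>x\<close>, and \<open>u\<^sup>-\<^sup>1u = u\<^sup>-\<^sup>1\<close> gives \<open>u = e\<^sub>u\<close>.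
\<close>

section \<open>Right preinverses and projections in \<open>P\<close>\<close>

locale unique_skew_pregroupoid =
  fixes P :: "'a set" and m :: "'a partial_op"
  assumes pregroupoid: "left_skew_pregroupoid P m"
    and unique: "unique_right_preinverses P m"
begin

abbreviation inv :: "'a \<Rightarrow> 'a" where
  "inv \<equiv> right_preinv P m"

text \<open>This is \<open>e\<^sub>x\<close>; for \<open>x\<close> in \<open>P\<close> the product
  is defined by \<open>mult_inv\<close>, so \<open>the\<close> is applied to a
  \<open>Some\<close>.\<close>

definition proj :: "'a \<Rightarrow> 'a" where
  "proj x = the (m x (inv x))"

lemma semigroupoid: "left_semigroupoid P m"
  using pregroupoid by (simp add: left_skew_pregroupoid_def left_skew_prepoloid_def)

lemma closed: "x \<in> P \<Longrightarrow> y \<in> P \<Longrightarrow> m x y = Some z \<Longrightarrow> z \<in> P"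
  using semigroupoid unfolding left_semigroupoid_def magmoid_def by blast

lemma assoc_right:
  assumes "x \<in> P" "y \<in> P" "z \<in> P" "m y z = Some w" "m x w = Some p"
  obtains v where "m x y = Some v" "m v z = Some p"
proof -
  have "prod_right m x y z = Some p"
    using assms by (simp add: prod_right_def)
  then have "prod_left m x y z = Some p"
    using semigroupoid assms(1-3) by (fastforce simp: left_semigroupoid_def)
  then show thesis
    using that by (auto simp: prod_left_def bind_eq_Some_conv)
qed

lemma assoc:
  assumes "x \<in> P" "y \<in> P" "z \<in> P" "m x y = Some v" "m y z = Some w"
  shows "m x w = m v z" "m x w \<noteq> None"
proof -
  obtain p where "prod_right m x y z = Some p" "prod_left m x y z = Some p"
    using semigroupoid assms by (fastforce simp: left_semigroupoid_def)
  then show "m x w = m v z" "m x w \<noteq> None"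
    using assms by (auto simp: prod_right_def prod_left_def)
qed

lemma preinverse_iff:
  "right_preinverse P m x y \<longleftrightarrow>
     y \<in> P \<and> (\<exists>e f. m x y = Some e \<and> m e x = Some x \<and> m y x = Some f \<and> m f y = Some y)"
  by (auto simp: right_preinverse_def prod_left_def bind_eq_Some_conv)

lemma preinverse_inv: "x \<in> P \<Longrightarrow> right_preinverse P m x (inv x)"
  using unique theI'[of "right_preinverse P m x"]
  by (simp add: right_preinv_def unique_right_preinverses_def)

lemma inv_eqI: "x \<in> P \<Longrightarrow> right_preinverse P m x y \<Longrightarrow> inv x = y"
  using unique preinverse_inv unfolding unique_right_preinverses_def by blast

lemma inv_closed [simp]: "x \<in> P \<Longrightarrow> inv x \<in> P"
  using preinverse_inv by (simp add: preinverse_iff)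

text \<open>The two equations that characterize a right preinverse are interchanged when the two
  elements swap roles.\<close>

lemma inv_inv [simp]: "x \<in> P \<Longrightarrow> inv (inv x) = x"
  using preinverse_inv[of x] by (intro inv_eqI) (auto simp: preinverse_iff)

lemma mult_inv: "x \<in> P \<Longrightarrow> m x (inv x) = Some (proj x)"
  using preinverse_inv[of x] by (auto simp: preinverse_iff proj_def)

lemma inv_mult: "x \<in> P \<Longrightarrow> m (inv x) x = Some (proj (inv x))"
  using mult_inv[of "inv x"] by simp

lemma proj_closed [simp]: "x \<in> P \<Longrightarrow> proj x \<in> P"
  using closed mult_inv inv_closed by blast

lemma proj_mult: "x \<in> P \<Longrightarrow> m (proj x) x = Some x"
  using preinverse_inv[of x] mult_inv[of x] by (auto simp: preinverse_iff)

lemma mult_proj_inv: "x \<in> P \<Longrightarrow> m x (proj (inv x)) = Some x"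
  using assoc(1)[of x "inv x" x] by (simp add: mult_inv inv_mult proj_mult)

lemma inv_mult_proj: "x \<in> P \<Longrightarrow> m (inv x) (proj x) = Some (inv x)"
  using mult_proj_inv[of "inv x"] by simp

lemma proj_idem: "x \<in> P \<Longrightarrow> m (proj x) (proj x) = Some (proj x)"
  using assoc(1)[of "proj x" x "inv x"] by (simp add: mult_inv proj_mult)

lemma proj_eqI: "x \<in> P \<Longrightarrow> right_preinverse P m x y \<Longrightarrow> m x y = Some e \<Longrightarrow> proj x = e"
  using inv_eqI by (fastforce simp: proj_def)

lemma proj_proj: "x \<in> P \<Longrightarrow> proj (proj x) = proj x"
  by (rule proj_eqI[where y = "proj x"]) (auto simp: preinverse_iff proj_idem)

text \<open>The left law applies because \<open>proj y\<close> is the product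
  \<open>yy\<^sup>-\<^sup>1\<close>. Hence on \<open>P\<close> the condition
  \<open>m x (proj y) = Some x\<close> alone decides whether \<open>rm x y\<close> is
  defined.\<close>

lemma mult_proj_defined:
  assumes "x \<in> P" "y \<in> P" "m x (proj y) = Some v"
  obtains w where "m x y = Some w"
  using assoc_right[OF assms(1,2) inv_closed mult_inv assms(3)] assms(2) by metis

lemma proj_mult_eq:
  assumes P: "y \<in> P" "z \<in> P" and yz: "m y (proj z) = Some y" "m y z = Some p"
  shows "proj p = proj y"
proof -
  let ?f = "proj (inv y)"
  have p: "p \<in> P"
    using closed P yz by blast
  have f: "?f \<in> P" "m ?f ?f = Some ?f" "m y ?f = Some y"
    using P by (auto simp: proj_idem mult_proj_inv)
  have fe: "m ?f (proj z) = Some ?f"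
    using assoc(1)[of "inv y" y "proj z" ?f y] P yz by (simp add: inv_mult)
  obtain w where w: "m ?f z = Some w"
    using mult_proj_defined[OF f(1) P(2) fe] .
  have wP: "w \<in> P"
    using closed f P w by blast
  let ?b = "inv w"
  have bP: "?b \<in> P"
    using wP by simp
  \<comment> \<open>\<open>wz\<^sup>-\<^sup>1 = f(zz\<^sup>-\<^sup>1) = fe\<^sub>z = f\<close>.\<close>
  have wz: "m w (inv z) = Some ?f"
    using assoc(1)[of ?f z "inv z" w "proj z"] f P w fe by (simp add: mult_inv)
  have fw: "m ?f w = Some w"
    using assoc(1)[of ?f ?f z ?f w] f P w by simp
  \<comment> \<open>\<open>c = w\<^sup>-\<^sup>1f\<close> is the rival right preinverse of
    \<open>w\<close>; it is defined because \<open>w\<^sup>-\<^sup>1w\<close> and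
    \<open>wz\<^sup>-\<^sup>1 = f\<close> are.\<close>
  obtain c where c: "m ?b ?f = Some c"
    using assoc(2)[of ?b w "inv z" _ ?f] bP wP P wz by (auto simp: inv_mult)
  have cP: "c \<in> P"
    using closed bP f c by blast
  have pf: "m (proj w) ?f = Some ?f"
    using assoc(1)[of "proj w" w "inv z" w ?f] wP P wz by (simp add: proj_mult)
  have wc: "m w c = Some ?f"
    using assoc(1)[of w ?b ?f "proj w" c] wP bP f c pf by (simp add: mult_inv)
  have cw: "m c w = Some (proj ?b)"
    using assoc(1)[of ?b ?f w c w] wP bP f c fw by (simp add: inv_mult)
  have "m (proj ?b) c = Some c"
    using assoc(1)[of "proj ?b" ?b ?f ?b c] bP f c by (simp add: proj_mult)
  then have "right_preinverse P m w c"
    using cP wc fw cw by (auto simp: preinverse_iff)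
  then have "c = ?b"
    using inv_eqI wP by blast
  then have wb: "m w ?b = Some ?f" and bf: "m ?b ?f = Some ?b"
    using wc c by auto
  \<comment> \<open>Since \<open>w\<^sup>-\<^sup>1f\<close> is defined and
    \<open>f = y\<^sup>-\<^sup>1y\<close>, the left law makes
    \<open>a = w\<^sup>-\<^sup>1y\<^sup>-\<^sup>1\<close> defined.\<close>
  obtain a where a: "m ?b (inv y) = Some a" "m a y = Some ?b"
    using assoc_right[of ?b "inv y" y ?f ?b] bP P bf by (auto simp: inv_mult)
  have aP: "a \<in> P"
    using closed[OF bP _ a(1)] P by simp
  have yw: "m y w = Some p"
    using assoc(1)[of y ?f z y w] P f w yz by simp
  have pb: "m p ?b = Some y"
    using assoc(1)[of y w ?b p ?f] P wP bP yw wb f by simp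
  have pa: "m p a = Some (proj y)"
    using assoc(1)[of p ?b "inv y" y a] P p bP pb a by (simp add: mult_inv)
  have ep: "m (proj y) p = Some p"
    using assoc(1)[of "proj y" y z y p] P yz by (simp add: proj_mult)
  have ae: "m a (proj y) = Some a"
    using assoc(1)[of ?b "inv y" "proj y" a "inv y"] P bP a by (simp add: inv_mult_proj)
  \<comment> \<open>\<open>ay\<close> and \<open>yz = p\<close> are defined, hence so is
    \<open>ap\<close>. Of its value only \<open>qa = a(pa) = ae\<^sub>y = a\<close> matters.\<close>
  obtain q where q: "m a p = Some q"
    using assoc(2)[of a y z ?b p] aP P a yz by auto
  have "m q a = Some a"
    using assoc(1)[of a p a q "proj y"] aP p q pa ae by simp
  then have "right_preinverse P m p a"
    using aP pa ep q by (auto simp: preinverse_iff)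
  then show ?thesis
    using proj_eqI p pa by blast
qed

section \<open>The restricted operation and its units\<close>

abbreviation rm :: "'a partial_op" where
  "rm \<equiv> restricted_op P m"

lemma restricted_eq_Some_iff:
  "x \<in> P \<Longrightarrow> y \<in> P \<Longrightarrow> rm x y = Some z \<longleftrightarrow> m x (proj y) = Some x \<and> m x y = Some z"
  by (simp add: restricted_op_def prod_right_def mult_inv)

lemma restricted_proj_mult: "x \<in> P \<Longrightarrow> rm (proj x) x = Some x"
  by (simp add: restricted_eq_Some_iff proj_idem proj_mult)

lemma restricted_mult_inv: "x \<in> P \<Longrightarrow> rm x (inv x) = Some (proj x)"
  by (simp add: restricted_eq_Some_iff mult_proj_inv mult_inv)

lemma restricted_inv_mult: "x \<in> P \<Longrightarrow> rm (inv x) x = Some (proj (inv x))"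
  using restricted_mult_inv[of "inv x"] by simp

text \<open>By \<open>proj_mult_eq\<close>, \<open>proj w = proj y\<close>, so multiplying by
  \<open>w\<close> or by \<open>y\<close> on the right puts the same condition on
  \<open>x\<close>.\<close>

lemma restricted_assoc:
  assumes P: "x \<in> P" "y \<in> P" "z \<in> P" and xy: "rm x y = Some v" and yz: "rm y z = Some w"
  shows "\<exists>p. rm x w = Some p \<and> rm v z = Some p"
proof -
  have xy': "m x (proj y) = Some x" "m x y = Some v"
    and yz': "m y (proj z) = Some y" "m y z = Some w"
    using xy yz P by (auto simp: restricted_eq_Some_iff)
  have vw: "v \<in> P" "w \<in> P"
    using closed P xy' yz' by blast+
  have "m v (proj z) = Some v"
    using assoc(1)[of x y "proj z" v y] P xy' yz' by simp
  moreover have "proj w = proj y"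
    using proj_mult_eq P yz' by blast
  ultimately show ?thesis
    using assoc[of x y z v w] P xy' yz' vw by (auto simp: restricted_eq_Some_iff)
qed

text \<open>Reduces the case where \<open>x(yz)\<close> is defined to
  \<open>restricted_assoc\<close>: \<open>proj w = proj y\<close> carries the condition on
  \<open>x\<close> back from \<open>w\<close> to \<open>y\<close>.\<close>

lemma restricted_assoc_defined:
  assumes P: "x \<in> P" "y \<in> P" "z \<in> P" and yz: "rm y z = Some w" and xw: "rm x w = Some p"
  obtains v where "rm x y = Some v"
proof -
  have yz': "m y (proj z) = Some y" "m y z = Some w"
    using yz P by (auto simp: restricted_eq_Some_iff)
  have w: "w \<in> P"
    using closed P yz' by blast
  have "m x (proj y) = Some x"
    using proj_mult_eq[OF P(2,3) yz'] xw P w by (simp add: restricted_eq_Some_iff)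
  then show thesis
    using mult_proj_defined P that by (metis restricted_eq_Some_iff)
qed

lemma restricted_semigroupoid: "left_semigroupoid P rm"
proof -
  obtain x where "x \<in> P"
    using semigroupoid unfolding left_semigroupoid_def magmoid_def by blast
  then have "\<exists>x\<in>P. \<exists>y\<in>P. rm x y \<noteq> None"
    using restricted_proj_mult proj_closed by blast
  then have "magmoid P rm"
    unfolding magmoid_def using \<open>x \<in> P\<close> closed restricted_eq_Some_iff by blast
  moreover have "\<exists>p. prod_right rm x y z = Some p \<and> prod_left rm x y z = Some p"
    if P: "x \<in> P" "y \<in> P" "z \<in> P"
      and *: "prod_right rm x y z \<noteq> None \<or> (rm x y \<noteq> None \<and> rm y z \<noteq> None)" for x y z
  proof -
    obtain w where w: "rm y z = Some w" and "rm x y \<noteq> None \<or> rm x w \<noteq> None"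
      using * by (auto simp: prod_right_def bind_eq_Some_conv)
    then obtain v where "rm x y = Some v"
      using restricted_assoc_defined[OF P w] by blast
    then show ?thesis
      using restricted_assoc[OF P _ w] w by (auto simp: prod_right_def prod_left_def)
  qed
  ultimately show ?thesis
    unfolding left_semigroupoid_def by blast
qed

text \<open>As \<open>proj\<close> is idempotent, the domain condition for
  \<open>rm y (proj x)\<close> is already the equation \<open>m y (proj x) = Some y\<close>.\<close>

lemma right_unit_proj: "x \<in> P \<Longrightarrow> right_unit P rm (proj x)"
  by (auto simp: right_unit_def restricted_eq_Some_iff proj_proj)

lemma twisted_left_unit_proj: "x \<in> P \<Longrightarrow> twisted_left_unit P rm x (proj x)"
  by (simp add: twisted_left_unit_def local_left_unit_def restricted_proj_mult right_unit_proj)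

lemma twisted_left_unit_unique:
  assumes x: "x \<in> P" and u: "twisted_left_unit P rm x u"
  shows "u = proj x"
proof -
  have uP: "u \<in> P" and ux: "rm u x = Some x" and unit: "right_unit P rm u"
    using u by (auto simp: twisted_left_unit_def local_left_unit_def)
  have "proj x = proj u"
    using proj_mult_eq[OF uP x] ux uP x by (simp add: restricted_eq_Some_iff)
  \<comment> \<open>\<open>rm (inv u) u\<close> is defined with value \<open>proj (inv u)\<close>,
    and the right unit \<open>u\<close> forces that value to be \<open>inv u\<close>.\<close>
  moreover have "proj (inv u) = inv u"
    using restricted_inv_mult[OF uP] unit inv_closed[OF uP] unfolding right_unit_def
    by (metis option.distinct(1) option.inject)
  \<comment> \<open>\<open>u = u(u\<^sup>-\<^sup>1u) = uu\<^sup>-\<^sup>1 = e\<^sub>u\<close>.\<close>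
  then have "u = proj u"
    using mult_proj_inv[OF uP] mult_inv[OF uP] by simp
  ultimately show ?thesis
    by simp
qed

lemma strong_right_preinverse_inv: "x \<in> P \<Longrightarrow> strong_right_preinverse P rm x (inv x)"
  using restricted_proj_mult[of "inv x"]
  by (simp add: strong_right_preinverse_def right_preinverse_def prod_left_def
      restricted_mult_inv restricted_inv_mult restricted_proj_mult right_unit_proj)

text \<open>Products in \<open>rm\<close> agree with those in \<open>m\<close>, so \<open>y\<close>
  is a right preinverse under \<open>m\<close>, where uniqueness applies. Strong right preinverses
  of \<open>x\<close> thus coincide, and so do their twisted left units.\<close>

lemma strong_right_preinverse_unique:
  assumes x: "x \<in> P" and y: "strong_right_preinverse P rm x y"
  shows "y = inv x"
proof -
  have "right_preinverse P m x y"
  proof -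
    obtain e f where yP: "y \<in> P"
      and rm: "rm x y = Some e" "rm e x = Some x" "rm y x = Some f" "rm f y = Some y"
      using y unfolding strong_right_preinverse_def right_preinverse_def prod_left_def
        bind_eq_Some_conv by blast
    then have "m x y = Some e" "m y x = Some f"
      using x by (simp_all add: restricted_eq_Some_iff)
    then have "e \<in> P" "f \<in> P"
      using closed x yP by blast+
    then show ?thesis
      using rm x yP by (simp add: preinverse_iff restricted_eq_Some_iff)
  qed
  then show ?thesis
    using inv_eqI x by simp
qed

lemma restricted_groupoid: "left_skew_groupoid P rm"
  unfolding left_skew_groupoid_def left_skew_poloid_def
  using restricted_semigroupoid twisted_left_unit_proj twisted_left_unit_unique
    strong_right_preinverse_inv strong_right_preinverse_unique by metis

end

theorem theorem8p6:
  fixes P :: "'a set" and m :: "'a partial_op"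
  assumes "left_skew_pregroupoid P m"
    and "unique_right_preinverses P m"
  shows "left_skew_groupoid P (restricted_op P m)"
  using assms by (intro unique_skew_pregroupoid.restricted_groupoid unique_skew_pregroupoid.intro)

end
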